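(* For any nonzero partition $\mu$ and any integer $j>0$, the $j$th plateau of $\mathrm{TAIL}(\mu)$ consists of the following Dyck classes, listed in order from lowest dinv to highest dinv: (a) first, $[01Z^+1^{j-1}Y]$ where $Y$ and $Z$ are nonempty strings such that $B_\mu=YZ$, listed in order from the shortest $Y$ to the longest $Y$; (b) second, $[01^aB_\mu 0^b]$ where $a,b\ge 0$ and $a+b=j$, listed in order from $b=0$ to $b=j$. For $\mu=\langle 0\rangle$ and $j>0$, the $j$th plateau of $\mathrm{TAIL}(\langle 0\rangle)$ consists of $[01^a0^b]$ where $a\ge 0$, $b>0$ and $a+b=j$, listed in order from $b=1$ to $b=j$.
   Context: Vectors and classes. A quasi-Dyck vector (QDV) is an integer sequence $v=v_1v_2\cdots v_n$ with $v_1=0$ and $v_{i+1}\le v_i+1$ for all $i<n$; a Dyck vector is a QDV with all entries $\ge 0$. We use word notation; $i^c$ means $c$ copies of $i$; $W^{+}$ adds $1$ to each entry of $W$. Dyck classes $[v]$ are the equivalence classes of the equivalence relation on QDVs generated by $v\sim 0v^+$. An integer partition $\lambda$ (with $\ell(\lambda)$ positive parts and $\lambda_i=0$ for $i>\ell(\lambda)$; the zero partition $\langle 0\rangle$ is allowed) is identified with the Dyck class consisting of all QDVs $\mathrm{QDV}_n(\lambda)=(0-\lambda_n,1-\lambda_{n-1},\ldots,n-1-\lambda_1)$, $n>\ell(\lambda)$; this is a bijection between partitions and Dyck classes. $\mathrm{min}_{\Delta}(\lambda)$ is the least $n>\ell(\lambda)$ such that $\mathrm{QDV}_n(\lambda)$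 has all entries nonnegative. For a QDV $v$ of length $n$, $\mathrm{dinv}(v)$ is the number of pairs of integers $i<j\le n$ with $v_i-v_j\in\{0,1\}$, where $v_k=k-1$ for all $k\le 0$; dinv is constant on Dyck classes. The map $\mathrm{NU}_1$ is defined on partitions $\gamma$ with $\gamma_1\le \ell(\gamma)+2$ by $\mathrm{NU}_1(\gamma)=\langle \ell+1,\gamma_1-1,\ldots,\gamma_\ell-1\rangle$, $\ell=\ell(\gamma)$ (zero parts dropped); it is viewed as acting on Dyck classes. For nonzero $\mu=\langle r^{n_r}\cdots 2^{n_2}1^{n_1}\rangle$ with $n_r>0$ ($n_i$ is the number of parts equal to $i$), $B_\mu=01^{n_1}01^{n_2}\cdots 01^{n_r}$; $B_{\langle 0\rangle}$ is the empty word. $\mathrm{TI}(\mu)=[0B_\mu]$, and $\mathrm{TAIL}(\mu)$ is the sequence of Dyck classes reachable from $\mathrm{TI}(\mu)$ by applying $\mathrm{NU}_1$ zero or more times. For $j\ge 0$, the $j$th plateau of $\mathrm{TAIL}(\mu)$ consists of all $[z]$ in $\mathrm{TAIL}(\mu)$ with $\mathrm{min}_{\Delta}([z])=n+j$, where $n=\mathrm{min}_{\Delta}(\mathrm{TI}(\mu))$. *)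

theory Defs
  imports Complex_Main
begin

definition is_qdv :: "int list \<Rightarrow> bool" where
  "is_qdv v \<longleftrightarrow> v \<noteq> [] \<and> v ! 0 = 0 \<and> (\<forall>i. Suc i < length v \<longrightarrow> v ! Suc i \<le> v ! i + 1)"

definition word_plus :: "int list \<Rightarrow> int list" where
  "word_plus W = map (\<lambda>x. x + 1) W"

definition dyck_equiv :: "(int list \<times> int list) set" where
  "dyck_equiv =
    {(v, w). is_qdv v \<and> is_qdv w \<and>
             equivclp (\<lambda>x y. is_qdv x \<and> y = 0 # word_plus x) v w}"

definition dyck_class :: "int list \<Rightarrow> int list set" where
  "dyck_class v = dyck_equiv `` {v}"

text \<open>A partition is the weakly decreasing list of its positive parts; the empty list is the
  zero partition, and the length of the list is the number of positive parts.\<close>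

definition int_partition :: "nat list \<Rightarrow> bool" where
  "int_partition p \<longleftrightarrow> sorted_wrt (\<ge>) p \<and> (\<forall>x \<in> set p. x > 0)"

text \<open>The \<open>i\<close>-th part, counting from 1; it is 0 beyond the length.\<close>

definition part :: "nat list \<Rightarrow> nat \<Rightarrow> nat" where
  "part p i = (if 1 \<le> i \<and> i \<le> length p then p ! (i - 1) else 0)"

definition qdv_of :: "nat \<Rightarrow> nat list \<Rightarrow> int list" where
  "qdv_of n p = map (\<lambda>k. int k - int (part p (n - k))) [0..<n]"

definition partition_class :: "nat list \<Rightarrow> int list set" where
  "partition_class p = {qdv_of n p | n. n > length p}"

text \<open>The inverse of the bijection \<^const>\<open>partition_class\<close> from partitions to Dyck classes.\<close>

definition partition_of :: "int list set \<Rightarrow> nat list" where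
  "partition_of c = (THE p. int_partition p \<and> partition_class p = c)"

definition min_delta :: "nat list \<Rightarrow> nat" where
  "min_delta p = (LEAST n. n > length p \<and> (\<forall>x \<in> set (qdv_of n p). x \<ge> 0))"

definition class_min_delta :: "int list set \<Rightarrow> nat" where
  "class_min_delta c = min_delta (partition_of c)"

text \<open>Entries are indexed from 1 and extended to all integer indices \<open>k \<le> 0\<close>.\<close>

definition ext_entry :: "int list \<Rightarrow> int \<Rightarrow> int" where
  "ext_entry v k = (if k \<le> 0 then k - 1 else v ! nat (k - 1))"

text \<open>The set of pairs is finite: two indices \<open>\<le> 0\<close> never contribute, and for each fixed
  \<open>j > 0\<close> at most two indices \<open>i \<le> 0\<close> do.\<close>

definition dinv :: "int list \<Rightarrow> nat" where
  "dinv v = card {(i, j). i < j \<and> j \<le> int (length v) \<and>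
                          ext_entry v i - ext_entry v j \<in> {0, 1}}"

text \<open>The common value of \<^const>\<open>dinv\<close> on a Dyck class.\<close>

definition class_dinv :: "int list set \<Rightarrow> nat" where
  "class_dinv c = (THE d. \<forall>v \<in> c. dinv v = d)"

definition NU1 :: "nat list \<Rightarrow> nat list" where
  "NU1 g = (length g + 1) # filter (\<lambda>x. x > 0) (map (\<lambda>x. x - 1) g)"

text \<open>The partial map \<^const>\<open>NU1\<close>, with its domain condition, as a relation on Dyck classes.\<close>

definition NU1_step :: "int list set \<Rightarrow> int list set \<Rightarrow> bool" where
  "NU1_step c d \<longleftrightarrow>
    (\<exists>g. int_partition g \<and> part g 1 \<le> length g + 2 \<and>
         c = partition_class g \<and> d = partition_class (NU1 g))"

text \<open>Since parts are weakly decreasing, the first part is the largest one, and it is 0 for the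
  zero partition, which therefore yields the empty word.\<close>

definition B_word :: "nat list \<Rightarrow> int list" where
  "B_word m = concat (map (\<lambda>i. 0 # replicate (count_list m i) 1) [1..<Suc (part m 1)])"

definition TI :: "nat list \<Rightarrow> int list set" where
  "TI m = dyck_class (0 # B_word m)"

definition TAIL :: "nat list \<Rightarrow> int list set set" where
  "TAIL m = {c. rtranclp NU1_step (TI m) c}"

definition plateau :: "nat list \<Rightarrow> nat \<Rightarrow> int list set set" where
  "plateau m j = {c \<in> TAIL m. class_min_delta c = class_min_delta (TI m) + j}"

text \<open>The list \<open>L\<close> enumerates the set \<open>P\<close> of Dyck classes from lowest to highest dinv;
  strictness makes \<open>L\<close> free of repetitions.\<close>

definition lists_by_dinv :: "int list set list \<Rightarrow> int list set set \<Rightarrow> bool" where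
  "lists_by_dinv L P \<longleftrightarrow> set L = P \<and> sorted_wrt (\<lambda>c d. class_dinv c < class_dinv d) L"

end

(* On the shortest quasi-Dyck vector of a class, NU_1 acts by [0A] to [0 A^+ 0] (where A_1 <= 0),
   and this raises dinv by exactly 1.  Since [v] = [0 v^+], the same rule reads
   [01A] to [0A0] and [012A] to [01A1].  So from [01Z^+1^(j-1)Y] a step moves the first letter
   of Z to the end of Y; once Z is used up, steps trade the letters 1 of [01^a B 0^b]
   for letters 0, and [0 B 0^j] is taken to the first word of the next plateau.
   All these words are Dyck vectors with a noninitial 0, so their length is min_Delta. *)

theory Submission
  imports Defs
begin

section \<open>Partitions read off quasi-Dyck vectors of a fixed length\<close>

section \<open>Partitions and quasi-Dyck vectors\<close>

lemma is_qdv_Cons: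
  "is_qdv (x # xs) \<longleftrightarrow> x = 0 \<and> successively (\<lambda>a b. b \<le> a + 1) (x # xs)"
  unfolding is_qdv_def by (auto simp: successively_conv_nth)

lemma is_qdv_iff:
  "is_qdv v \<longleftrightarrow> v \<noteq> [] \<and> hd v = 0 \<and> successively (\<lambda>a b. b \<le> a + 1) v"
  by (cases v) (auto simp: is_qdv_Cons, simp add: is_qdv_def)

lemma successively_word_plus [simp]:
  "successively (\<lambda>a b. b \<le> a + 1) (word_plus v) \<longleftrightarrow> successively (\<lambda>a b. b \<le> a + 1) v"
  by (simp add: word_plus_def successively_map add.commute)

lemma word_plus_simps [simp]:
  "word_plus [] = []" "word_plus (x # xs) = (x + 1) # word_plus xs"
  "word_plus (xs @ ys) = word_plus xs @ word_plus ys"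
  "word_plus xs = [] \<longleftrightarrow> xs = []" "length (word_plus xs) = length xs"
  "word_plus (replicate n x) = replicate n (x + 1)"
  by (auto simp: word_plus_def)

lemma inj_word_plus: "inj word_plus"
  by (auto simp: inj_def word_plus_def inj_map_eq_map)

lemma qdv_entry_le: "is_qdv v \<Longrightarrow> i < length v \<Longrightarrow> v ! i \<le> int i"
proof (induction i)
  case 0
  then show ?case by (simp add: is_qdv_def)
next
  case (Suc i)
  then have "v ! Suc i \<le> v ! i + 1" by (auto simp: is_qdv_def)
  with Suc show ?case by simp
qed

text \<open>The gaps \<open>int i - v ! i\<close> are the parts of the associated partition, so this
  is the source of their ordering: a step of \<open>v\<close> rises by at most 1, while the index
  rises by exactly 1.\<close>

lemma qdv_codiff_mono:
  assumes "is_qdv v" "i \<le> k" "k < length v"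
  shows "int i - v ! i \<le> int k - v ! k"
  using assms(2,3)
proof (induction k rule: dec_induct)
  case (step k)
  then have "v ! Suc k \<le> v ! k + 1" using assms(1) by (auto simp: is_qdv_def)
  with step show ?case by simp
qed simp

lemma length_qdv_of [simp]: "length (qdv_of n p) = n"
  by (simp add: qdv_of_def)

lemma nth_qdv_of: "k < n \<Longrightarrow> qdv_of n p ! k = int k - int (part p (n - k))"
  by (simp add: qdv_of_def)

lemma part_eq_0: "length p < i \<Longrightarrow> part p i = 0"
  by (simp add: part_def)

lemma part_pos: "int_partition p \<Longrightarrow> 0 < i \<Longrightarrow> part p i = 0 \<Longrightarrow> length p < i"
  by (cases i) (auto simp: part_def int_partition_def all_set_conv_all_nth Suc_le_eq
      split: if_splits)

lemma part_antimono:
  assumes "int_partition p" "0 < i" "i \<le> k"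
  shows "part p k \<le> part p i"
  using assms sorted_wrt_nth_less[of "(\<ge>)" p "i - 1" "k - 1"]
  by (cases "i = k") (auto simp: part_def int_partition_def)

lemma part_Cons: "part (x # xs) (Suc i) = (if i = 0 then x else part xs i)"
  by (auto simp: part_def nth_Cons')

text \<open>In a weakly decreasing list the zeros stand at the end, and \<open>part\<close> already
  returns 0 beyond the end.\<close>

lemma part_filter_pos:
  "sorted_wrt (\<ge>) xs \<Longrightarrow> part (filter (\<lambda>x. x > 0) xs) i = part xs i"
proof (induction xs arbitrary: i)
  case (Cons x xs)
  show ?case
  proof (cases "x = 0")
    case True
    with Cons.prems have "\<forall>y \<in> set (x # xs). y = 0" by auto
    then have "filter (\<lambda>x. x > 0) (x # xs) = []" by (auto simp: filter_empty_conv)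
    moreover have "part (x # xs) i = 0"
      using \<open>\<forall>y \<in> set (x # xs). y = 0\<close> nth_mem[of "i - 1" "x # xs"]
      by (auto simp: part_def simp del: nth_mem)
    ultimately show ?thesis by (metis list.size(3) part_def le_zero_eq not_one_le_zero order_trans)
  next
    case False
    with Cons show ?thesis by (cases i) (auto simp: part_Cons, auto simp: part_def)
  qed
qed simp

text \<open>Ties the family \<open>qdv_of n p\<close> to Dyck equivalence: raising the length by one
  is one generating step.\<close>

lemma qdv_of_Suc: "length p < n \<Longrightarrow> qdv_of (Suc n) p = 0 # word_plus (qdv_of n p)"
  by (rule nth_equalityI)
     (auto simp: nth_qdv_of nth_Cons' word_plus_def part_eq_0 Suc_diff_le)

lemma is_qdv_qdv_of:
  assumes "int_partition p" "length p < n"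
  shows "is_qdv (qdv_of n p)"
proof -
  have "qdv_of n p \<noteq> []" using assms(2) by (metis length_qdv_of list.size(3) not_less_zero)
  moreover have "qdv_of n p ! 0 = 0" using assms(2) by (simp add: nth_qdv_of part_eq_0)
  moreover have "qdv_of n p ! Suc i \<le> qdv_of n p ! i + 1" if "Suc i < n" for i
    using that part_antimono[OF assms(1), of "n - Suc i" "n - i"]
    by (simp add: nth_qdv_of)
  ultimately show ?thesis by (simp add: is_qdv_def)
qed

text \<open>Position \<open>n - i\<close> recovers part \<open>i\<close>. As \<open>n\<close>
  exceeds both lengths, the first vanishing part is visible too, which forces equal lengths.\<close>

lemma qdv_of_inject:
  assumes "int_partition p" "int_partition q" "length p < n" "length q < n"
    and eq: "qdv_of n p = qdv_of n q"
  shows "p = q"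
proof -
  have *: "part p i = part q i" if "0 < i" "i \<le> n" for i
    using arg_cong[OF eq, of "\<lambda>v. v ! (n - i)"] that by (simp add: nth_qdv_of)
  have "length p = length q"
  proof (rule antisym)
    have "part q (Suc (length p)) = 0"
      using *[of "Suc (length p)"] assms(3) by (simp add: part_eq_0)
    then show "length q \<le> length p" using part_pos[OF assms(2), of "Suc (length p)"] by simp
    have "part p (Suc (length q)) = 0"
      using *[of "Suc (length q)"] assms(4) by (simp add: part_eq_0)
    then show "length p \<le> length q" using part_pos[OF assms(1), of "Suc (length q)"] by simp
  qed
  moreover have "p ! i = q ! i" if "i < length p" for i
    using *[of "Suc i"] that assms(3) \<open>length p = length q\<close> by (simp add: part_def)
  ultimately show ?thesis by (rule nth_equalityI)
qed

lemma partition_class_inject: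
  assumes "int_partition p" "int_partition q" "partition_class p = partition_class q"
  shows "p = q"
proof -
  \<comment> \<open>A length large enough for both partitions, so that their vectors can be
    compared.\<close>
  define n where "n = Suc (length p + length q)"
  have "qdv_of n p \<in> partition_class q"
    unfolding assms(3)[symmetric] by (auto simp: partition_class_def n_def)
  then obtain m where "m > length q" "qdv_of n p = qdv_of m q"
    by (auto simp: partition_class_def)
  moreover from this have "m = n" by (metis length_qdv_of)
  ultimately show ?thesis using qdv_of_inject[OF assms(1,2), of n] by (simp add: n_def)
qed

lemma partition_of_partition_class:
  "int_partition p \<Longrightarrow> partition_of (partition_class p) = p"
  unfolding partition_of_def by (rule the_equality) (auto dest: partition_class_inject)

lemma qdv_obtain_partition:
  assumes "is_qdv v"
  obtains p where "int_partition p" "length p < length v" "qdv_of (length v) p = v"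
proof
  define n where "n = length v"
  \<comment> \<open>The gaps read from right to left are the parts, largest first. Position 0 is
    skipped because its gap is 0; remaining zeros are filtered out below.\<close>
  define g where "g = rev (map (\<lambda>k. nat (int k - v ! k)) [1..<n])"
  have "n > 0" using assms by (auto simp: is_qdv_def n_def)
  have len: "length g = n - 1" by (simp add: g_def)
  have nth: "g ! i = nat (int (n - Suc i) - v ! (n - Suc i))" if "i < n - 1" for i
    using that nth_upt[of 1 "n - Suc (Suc i)" n] by (simp add: g_def rev_nth Suc_diff_Suc)
  have sorted: "sorted_wrt (\<ge>) g"
    unfolding sorted_wrt_iff_nth_less
  proof (intro allI impI)
    fix i k assume "i < k" "k < length g"
    then have *: "n - Suc k \<le> n - Suc i" "n - Suc i < length v" using \<open>n > 0\<close> by (auto simp: n_def)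
    show "g ! k \<le> g ! i"
      using \<open>i < k\<close> \<open>k < length g\<close> qdv_codiff_mono[OF assms *] by (simp add: nth len nat_mono)
  qed
  let ?p = "filter (\<lambda>x. x > 0) g"
  show "int_partition ?p"
    using sorted by (auto simp: int_partition_def sorted_wrt_filter)
  have "length ?p \<le> length g" by (rule length_filter_le)
  then show "length ?p < length v" using \<open>n > 0\<close> len n_def by linarith
  have "int k - int (part g (n - k)) = v ! k" if "k < n" for k
  proof (cases "k = 0")
    case True
    then show ?thesis using assms \<open>n > 0\<close> by (simp add: part_eq_0 len is_qdv_def)
  next
    case False
    with that have "part g (n - k) = nat (int k - v ! k)"
      using nth[of "n - Suc k"] by (auto simp: part_def len Suc_diff_Suc)
    then show ?thesis using qdv_entry_le[OF assms, of k] that by (simp add: n_def)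
  qed
  then show "qdv_of (length v) ?p = v"
    by (intro nth_equalityI) (auto simp: nth_qdv_of part_filter_pos[OF sorted] n_def)
qed

section \<open>Dyck classes as partition classes, and the value of min_Delta\<close>

section \<open>Dyck classes\<close>

abbreviation dyck_shift :: "int list \<Rightarrow> int list \<Rightarrow> bool" where
  "dyck_shift x y \<equiv> is_qdv x \<and> y = 0 # word_plus x"

lemma mem_dyck_class:
  "w \<in> dyck_class v \<longleftrightarrow> is_qdv v \<and> is_qdv w \<and> equivclp dyck_shift v w"
  by (auto simp: dyck_class_def dyck_equiv_def)

lemma equivclp_qdv_of:
  assumes "int_partition p" "length p < n" "n \<le> m"
  shows "equivclp dyck_shift (qdv_of n p) (qdv_of m p)"
  using assms(3)
proof (induction m rule: dec_induct)
  case (step m)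
  have "dyck_shift (qdv_of m p) (qdv_of (Suc m) p)"
    using step assms by (simp add: qdv_of_Suc is_qdv_qdv_of)
  from equivclp_into_equivclp[of dyck_shift, OF step.IH disjI1, OF this] show ?case .
qed simp

text \<open>All vectors of one partition are joined by shifts; conversely, a shift in either
  direction keeps the partition, only the length changes.\<close>

lemma dyck_class_qdv_of:
  assumes "int_partition p" "length p < n"
  shows "dyck_class (qdv_of n p) = partition_class p"
proof (intro equalityI subsetI)
  fix w assume "w \<in> partition_class p"
  then obtain m where m: "length p < m" "w = qdv_of m p" by (auto simp: partition_class_def)
  have "equivclp dyck_shift (qdv_of n p) (qdv_of m p)"
    using equivclp_qdv_of[OF assms, of m] equivclp_sym[OF equivclp_qdv_of[OF assms(1) m(1), of n]]
    by (cases "n \<le> m") auto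
  then show "w \<in> dyck_class (qdv_of n p)"
    using assms m by (simp add: mem_dyck_class is_qdv_qdv_of)
next
  fix w assume "w \<in> dyck_class (qdv_of n p)"
  then have "equivclp dyck_shift (qdv_of n p) w" by (simp add: mem_dyck_class)
  then show "w \<in> partition_class p"
  proof (induction rule: equivclp_induct)
    case base
    then show ?case using assms by (auto simp: partition_class_def)
  next
    case (step y z)
    then obtain m where m: "length p < m" "y = qdv_of m p" by (auto simp: partition_class_def)
    from step(2) show ?case
    proof
      assume "dyck_shift y z"
      then have "z = qdv_of (Suc m) p" using m by (simp add: qdv_of_Suc)
      then show ?thesis using m by (auto simp: partition_class_def)
    next
      assume zy: "dyck_shift z y"
      then have "z \<noteq> []" "z ! 0 = 0" by (auto simp: is_qdv_def)
      moreover have "m = Suc (length z)" using m zy by (metis length_qdv_of length_Cons word_plus_simps(5))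
      ultimately obtain k where k: "m = Suc (Suc k)" by (cases z) auto
      \<comment> \<open>\<open>y\<close> is a shift of \<open>z\<close>, so its second entry is
        \<open>z ! 0 + 1\<close>. Hence part \<open>m - 1\<close> vanishes, and the vector of length
        \<open>m - 1\<close> still belongs to \<open>p\<close>.\<close>
      have "y ! 1 = 1" using zy \<open>z \<noteq> []\<close> \<open>z ! 0 = 0\<close> by (cases z) auto
      then have "part p (Suc k) = 0" using m k by (simp add: nth_qdv_of)
      then have *: "length p < Suc k" by (intro part_pos[OF assms(1)]) auto
      then have "word_plus z = word_plus (qdv_of (Suc k) p)"
        using qdv_of_Suc[OF *] m zy k by simp
      then have "z = qdv_of (Suc k) p" using inj_word_plus by (simp add: inj_def)
      then show ?thesis using * by (auto simp: partition_class_def)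
    qed
  qed
qed

lemma dyck_class_shift:
  assumes "is_qdv v"
  shows "dyck_class (0 # word_plus v) = dyck_class v"
proof -
  obtain p where p: "int_partition p" "length p < length v" "qdv_of (length v) p = v"
    using qdv_obtain_partition[OF assms] .
  have "dyck_class (qdv_of (Suc (length v)) p) = dyck_class (qdv_of (length v) p)"
    using p(1,2) by (simp only: dyck_class_qdv_of less_SucI)
  then show ?thesis using p(2,3) by (simp add: qdv_of_Suc)
qed

text \<open>If a shorter vector of the class were nonnegative, \<open>v\<close> would be the shift
  of a nonnegative vector and have no 0 after its first letter. The vector \<open>[0]\<close> has
  the least possible length.\<close>

lemma class_min_delta_dyck:
  assumes v: "is_qdv v" and nonneg: "\<forall>x \<in> set v. x \<ge> 0" and zero: "v = [0] \<or> 0 \<in> set (tl v)"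
  shows "class_min_delta (dyck_class v) = length v"
proof -
  obtain p where p: "int_partition p" "length p < length v" "qdv_of (length v) p = v"
    using qdv_obtain_partition[OF v] .
  have cls: "dyck_class v = partition_class p"
    using dyck_class_qdv_of[OF p(1,2)] p(3) by simp
  have "min_delta p = length v"
    unfolding min_delta_def
  proof (rule Least_equality)
    show "length v > length p \<and> (\<forall>x \<in> set (qdv_of (length v) p). x \<ge> 0)"
      using p nonneg by simp
  next
    fix n assume n: "n > length p \<and> (\<forall>x \<in> set (qdv_of n p). x \<ge> 0)"
    show "length v \<le> n"
    proof (rule ccontr)
      assume "\<not> length v \<le> n"
      then obtain k where k: "length v = Suc k" "n \<le> k" by (cases "length v") auto
      \<comment> \<open>Each shift prepends 0 and adds 1, so nonnegativity passes from length
        \<open>n\<close> up to length \<open>k\<close>, one below that of \<open>v\<close>.\<close>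
      from k(2) have "\<forall>x \<in> set (qdv_of k p). x \<ge> 0"
      proof (induction k rule: dec_induct)
        case (step k)
        then show ?case using n by (auto simp: qdv_of_Suc word_plus_def)
      qed (use n in simp)
      moreover have "v = 0 # word_plus (qdv_of k p)"
        using p(3) k n qdv_of_Suc[of p k] by simp
      ultimately have "0 \<notin> set (tl v)" by (auto simp: word_plus_def)
      with zero k n show False by simp
    qed
  qed
  then show ?thesis using p(1) cls by (simp add: class_min_delta_def partition_of_partition_class)
qed

section \<open>Computing dinv by adding one letter at a time\<close>

section \<open>The statistic dinv\<close>

definition dinv_pairs :: "int list \<Rightarrow> (int \<times> int) set" where
  "dinv_pairs v = {(i, j). i < j \<and> j \<le> int (length v) \<and> ext_entry v i - ext_entry v j \<in> {0, 1}}"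

text \<open>The indices that form a counted pair with a letter \<open>x\<close> appended to
  \<open>v\<close>.\<close>

definition dinv_row :: "int list \<Rightarrow> int \<Rightarrow> int set" where
  "dinv_row v x = {i. i \<le> int (length v) \<and> ext_entry v i - x \<in> {0, 1}}"

lemma dinv_eq_card_pairs: "dinv v = card (dinv_pairs v)"
  by (simp add: dinv_def dinv_pairs_def)

lemma ext_entry_snoc:
  "ext_entry (v @ [x]) i = (if i = int (length v) + 1 then x else ext_entry v i)"
  if "i \<le> int (length v) + 1"
  using that by (auto simp: ext_entry_def nth_append)

text \<open>An index \<open>i \<le> 0\<close> carries the entry \<open>i - 1\<close>, so only
  \<open>x + 1\<close> and \<open>x + 2\<close> can count there. Positive indices are list positions
  moved by one, since lists are indexed from 0.\<close>

lemma dinv_row_split: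
  "dinv_row v x = ({x + 1, x + 2} \<inter> {..0}) \<union>
     (\<lambda>i. int i + 1) ` {i. i < length v \<and> v ! i - x \<in> {0, 1}}" (is "_ = ?N \<union> ?P")
proof (rule set_eqI)
  fix i :: int
  show "i \<in> dinv_row v x \<longleftrightarrow> i \<in> ?N \<union> ?P"
  proof (cases "i \<le> 0")
    case True
    then have "i \<notin> ?P" by auto
    with True show ?thesis by (auto simp: dinv_row_def ext_entry_def)
  next
    case False
    then have "i = int (nat (i - 1)) + 1" by simp
    then obtain k where k: "i = int k + 1" ..
    have "ext_entry v i = v ! k" by (simp add: k ext_entry_def)
    then have "i \<in> dinv_row v x \<longleftrightarrow> k < length v \<and> v ! k - x \<in> {0, 1}"
      unfolding dinv_row_def mem_Collect_eq by (simp only: k) linarith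
    moreover have "i \<in> ?P \<longleftrightarrow> k < length v \<and> v ! k - x \<in> {0, 1}"
      unfolding k by (auto simp: image_iff)
    moreover have "i \<notin> ?N" using False by simp
    ultimately show ?thesis by blast
  qed
qed

lemma finite_dinv_row: "finite (dinv_row v x)"
  by (simp add: dinv_row_split)

lemma card_dinv_row:
  "card (dinv_row v x) =
     card ({x + 1, x + 2} \<inter> {..0}) + length (filter (\<lambda>y. y - x \<in> {0, 1}) v)"
proof -
  have "card ((\<lambda>i. int i + 1) ` {i. i < length v \<and> v ! i - x \<in> {0, 1}})
      = length (filter (\<lambda>y. y - x \<in> {0, 1}) v)"
    by (subst card_image) (auto simp: inj_on_def length_filter_conv_card)
  then show ?thesis
    unfolding dinv_row_split by (subst card_Un_disjoint) auto
qed

lemma dinv_pairs_snoc: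
  "dinv_pairs (v @ [x]) = dinv_pairs v \<union> (\<lambda>i. (i, int (length v) + 1)) ` dinv_row v x"
  by (auto simp: dinv_pairs_def dinv_row_def ext_entry_snoc image_iff split: if_splits)

lemma dinv_pairs_Nil: "dinv_pairs [] = {}"
  by (auto simp: dinv_pairs_def ext_entry_def)

lemma finite_dinv_pairs: "finite (dinv_pairs v)"
  by (induction v rule: rev_induct) (auto simp: dinv_pairs_Nil dinv_pairs_snoc finite_dinv_row)

text \<open>The recursion behind the computations below: new pairs all end in the new letter, and
  its row splits into implicit entries and letters of \<open>v\<close>.\<close>

lemma dinv_snoc:
  "dinv (v @ [x]) = dinv v + card ({x + 1, x + 2} \<inter> {..0})
     + length (filter (\<lambda>y. y - x \<in> {0, 1}) v)"
proof -
  have "dinv (v @ [x]) = card (dinv_pairs v) + card ((\<lambda>i. (i, int (length v) + 1)) ` dinv_row v x)"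
    unfolding dinv_eq_card_pairs dinv_pairs_snoc
  proof (rule card_Un_disjoint)
    show "dinv_pairs v \<inter> (\<lambda>i. (i, int (length v) + 1)) ` dinv_row v x = {}"
      by (auto simp: dinv_pairs_def)
  qed (simp_all add: finite_dinv_pairs finite_dinv_row)
  then show ?thesis
    by (simp add: card_image inj_on_def card_dinv_row dinv_eq_card_pairs)
qed

lemma card_dinv_row_neg:
  "card ({x + 1, x + 2} \<inter> {..0}) = (if x \<le> -2 then 2 else if x = -1 then 1 else 0)" for x :: int
proof -
  have "{x + 1, x + 2} \<inter> {..0} = (if x \<le> -2 then {x + 1, x + 2} else if x = -1 then {0} else {})"
    by auto
  then show ?thesis by simp
qed

lemma filter_word_plus:
  "length (filter (\<lambda>y. y - x \<in> {0, 1}) (word_plus v)) = length (filter (\<lambda>y. y - (x - 1) \<in> {0, 1}) v)"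
proof -
  have "(\<lambda>y. y - x \<in> {0, 1}) \<circ> (\<lambda>y. y + 1) = (\<lambda>y. y - (x - 1) \<in> {0, 1})"
    by (auto simp: fun_eq_iff)
  then show ?thesis by (simp only: word_plus_def filter_map length_map)
qed

lemma dinv_shift: "dinv (0 # word_plus v) = dinv v"
proof (induction v rule: rev_induct)
  case Nil
  then show ?case using dinv_snoc[of "[]" 0] by (simp add: card_dinv_row_neg)
next
  case (snoc x v)
  \<comment> \<open>The implicit entry -1, once raised, becomes the explicit leading 0; the pair it
    may form with the letter only changes sides in the count.\<close>
  have "card ({x + 1 + 1, x + 1 + 2} \<inter> {..0}) + (if 0 - (x + 1) \<in> {0, 1} then 1 else 0)
      = card ({x + 1, x + 2} \<inter> {..0})"
    unfolding card_dinv_row_neg by auto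
  then show ?case
    using dinv_snoc[of "0 # word_plus v" "x + 1"] dinv_snoc[of v x] filter_word_plus[of "x + 1" v] snoc
    by (simp del: insert_iff split: if_splits)
qed

text \<open>The leading 0 forms a pair exactly with the later letters 0 and -1. The condition is
  written with \<open>-1\<close> to match what \<open>filter_word_plus\<close> yields for a final 0
  after raising.\<close>

lemma dinv_Cons_0:
  "dinv (0 # A) = dinv A + length (filter (\<lambda>y. y - (-1) \<in> {0, 1}) A)"
proof (induction A rule: rev_induct)
  case Nil
  then show ?case using dinv_snoc[of "[]" 0] by (simp add: card_dinv_row_neg)
next
  case (snoc x A)
  have "(if 0 - x \<in> {0, 1} then 1 else 0) = (if x - (-1) \<in> {0, 1} then 1 else (0::nat))" by auto
  then show ?case using dinv_snoc[of "0 # A" x] dinv_snoc[of A x] snoc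
    by (simp del: insert_iff split: if_splits)
qed

text \<open>The final 0 pairs with the letters of A equal to -1 or 0 before raising, just as the
  leading 0 does in \<open>0 # A\<close>. The one additional pair is formed by the leading and the
  final 0.\<close>

lemma dinv_raise: "dinv (0 # word_plus A @ [0]) = Suc (dinv (0 # A))"
  using dinv_snoc[of "0 # word_plus A" 0] filter_word_plus[of 0 A] dinv_Cons_0[of A]
  by (simp add: dinv_shift card_dinv_row_neg)

text \<open>Shifts preserve \<open>dinv\<close>, so the definite description in
  \<open>class_dinv\<close> has a unique solution.\<close>

lemma class_dinv_dyck:
  assumes "is_qdv v"
  shows "class_dinv (dyck_class v) = dinv v"
proof -
  have "dinv w = dinv v" if "w \<in> dyck_class v" for w
  proof -
    have "equivclp dyck_shift v w" using that by (simp add: mem_dyck_class)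
    then show ?thesis by (induction rule: equivclp_induct) (auto simp: dinv_shift)
  qed
  moreover have "v \<in> dyck_class v" using assms by (simp add: mem_dyck_class)
  ultimately show ?thesis
    unfolding class_dinv_def by (intro the_equality) metis+
qed

section \<open>NU_1 as a rewriting rule on words\<close>

section \<open>The map NU1 on Dyck classes\<close>

text \<open>The domain condition is what places the new part first: the old largest part minus 1 is
  at most \<open>length g + 1\<close>.\<close>

lemma int_partition_NU1:
  assumes "int_partition g" "part g 1 \<le> length g + 2"
  shows "int_partition (NU1 g)"
proof -
  have "sorted_wrt (\<ge>) (map (\<lambda>x. x - 1) g)"
    using assms(1) by (auto simp: int_partition_def sorted_wrt_map intro: sorted_wrt_mono_rel[rotated])
  moreover have "x - 1 \<le> length g + 1" if "x \<in> set g" for x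
  proof -
    obtain i where "i < length g" "x = g ! i" using \<open>x \<in> set g\<close> by (metis in_set_conv_nth)
    then have "x \<le> part g 1" using part_antimono[OF assms(1), of 1 "Suc i"] by (simp add: part_def)
    then show ?thesis using assms(2) by simp
  qed
  ultimately show ?thesis by (auto simp: int_partition_def NU1_def sorted_wrt_filter)
qed

text \<open>Dropping zeros does not affect \<open>part\<close>, and truncated subtraction keeps the
  value 0 past the last part.\<close>

lemma part_NU1:
  assumes "int_partition g"
  shows "part (NU1 g) (Suc i) = (if i = 0 then length g + 1 else part g i - 1)"
proof -
  have "sorted_wrt (\<ge>) (map (\<lambda>x. x - 1) g)"
    using assms(1) by (auto simp: int_partition_def sorted_wrt_map intro: sorted_wrt_mono_rel[rotated])
  then have "part (NU1 g) (Suc i) = (if i = 0 then length g + 1 else part (map (\<lambda>x. x - 1) g) i)"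
    by (simp add: NU1_def part_Cons part_filter_pos)
  then show ?thesis by (auto simp: part_def)
qed

lemma length_NU1: "length (NU1 g) \<le> Suc (length g)"
  using length_filter_le[of "\<lambda>x. x > 0" "map (\<lambda>x. x - 1) g"] by (simp add: NU1_def)

text \<open>Each part moves one place on and loses 1, which raises its letter; the new part
  \<open>length g + 1\<close> produces the final 0.\<close>

lemma qdv_of_NU1:
  assumes "int_partition g"
  shows "qdv_of (length g + 2) (NU1 g) = 0 # word_plus (tl (qdv_of (length g + 1) g)) @ [0]"
proof (rule nth_equalityI)
  fix k assume "k < length (qdv_of (length g + 2) (NU1 g))"
  then have k: "k < length g + 2" by simp
  define n where "n = length g + 1"
  consider "k = 0" | i where "k = Suc i" "i < length g" | "k = length g + 1"
    using k by (cases k) (auto simp: less_Suc_eq)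
  then show "qdv_of (length g + 2) (NU1 g) ! k
      = (0 # word_plus (tl (qdv_of (length g + 1) g)) @ [0]) ! k"
  proof cases
    case 1
    then show ?thesis by (simp add: nth_qdv_of part_NU1[OF assms] part_eq_0)
  next
    case (2 i)
    \<comment> \<open>Positivity makes the natural subtraction in \<open>part_NU1\<close>
      exact.\<close>
    then have "part g (length g - i) > 0" using part_pos[OF assms, of "length g - i"] by fastforce
    moreover have "length g + 2 - k = Suc (length g - i)" using 2 by simp
    ultimately have "qdv_of (length g + 2) (NU1 g) ! k = int k + 1 - int (part g (length g - i))"
      using 2 by (simp add: nth_qdv_of part_NU1[OF assms])
    then show ?thesis using 2
      by (simp add: nth_append word_plus_def nth_tl nth_qdv_of)
  next
    case 3
    then show ?thesis by (simp add: nth_qdv_of part_NU1[OF assms] nth_append)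
  qed
qed simp

lemma NU1_step_deterministic: "NU1_step c d \<Longrightarrow> NU1_step c d' \<Longrightarrow> d = d'"
  unfolding NU1_step_def using partition_class_inject by metis

lemma NU1_step_class_dinv:
  assumes "NU1_step c d"
  shows "class_dinv d = Suc (class_dinv c)"
proof -
  obtain g where g: "int_partition g" "part g 1 \<le> length g + 2"
      "c = partition_class g" "d = partition_class (NU1 g)"
    using assms by (auto simp: NU1_step_def)
  define v where "v = qdv_of (length g + 1) g"
  define w where "w = qdv_of (length g + 2) (NU1 g)"
  have len: "length (NU1 g) < length g + 2" using length_NU1[of g] by simp
  have v: "is_qdv v" "c = dyck_class v"
    using g by (simp_all add: v_def is_qdv_qdv_of dyck_class_qdv_of)
  have w: "is_qdv w" "d = dyck_class w"
    using g(4) len int_partition_NU1[OF g(1,2)] by (simp_all add: w_def is_qdv_qdv_of dyck_class_qdv_of)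
  have "v = 0 # tl v" using v(1) by (cases v) (auto simp: is_qdv_iff)
  moreover have "w = 0 # word_plus (tl v) @ [0]"
    unfolding v_def w_def using qdv_of_NU1[OF g(1)] .
  ultimately have "dinv w = Suc (dinv v)" using dinv_raise[of "tl v"] by metis
  then show ?thesis using v w by (simp add: class_dinv_dyck)
qed

text \<open>The bound on \<open>hd A\<close> makes \<open>0 # A\<close> the shortest vector of its
  class, so that \<open>length g = length A\<close>. The last letter is \<open>length A\<close>
  minus the first part, so the bound -2 is the domain condition of \<open>NU1\<close>.\<close>

lemma NU1_step_level_0:
  assumes "is_qdv (0 # A)" "A = [] \<or> hd A \<le> 0" "last (0 # A) \<ge> -2"
  shows "NU1_step (dyck_class (0 # A)) (dyck_class (0 # word_plus A @ [0]))"
proof -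
  obtain g where g: "int_partition g" "length g < length (0 # A)" "qdv_of (length (0 # A)) g = 0 # A"
    using qdv_obtain_partition[OF assms(1)] .
  have len: "length g = length A"
  proof (cases A)
    case Nil
    then show ?thesis using g(2) by simp
  next
    case (Cons a A')
    have "a = 1 - int (part g (length A))"
      using arg_cong[OF g(3), of "\<lambda>v. v ! 1"] Cons by (simp add: nth_qdv_of)
    then have "part g (length A) > 0" using assms(2) Cons by auto
    then have "length A \<le> length g" using part_eq_0[of g "length A"] by fastforce
    then show ?thesis using g(2) by simp
  qed
  have "last (0 # A) = (0 # A) ! length A" by (simp add: last_conv_nth)
  also have "\<dots> = int (length A) - int (part g 1)"
    by (subst g(3)[symmetric]) (simp add: nth_qdv_of)
  finally have dom: "part g 1 \<le> length g + 2" using assms(3) len by simp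
  have "dyck_class (0 # A) = partition_class g"
    using dyck_class_qdv_of[OF g(1,2)] g(3) by simp
  moreover have "dyck_class (0 # word_plus A @ [0]) = partition_class (NU1 g)"
    using dyck_class_qdv_of[OF int_partition_NU1[OF g(1) dom], of "length g + 2"]
      qdv_of_NU1[OF g(1)] length_NU1[of g] g(3) len by simp
  ultimately show ?thesis using g(1) dom by (auto simp: NU1_step_def)
qed

text \<open>With A' the word A lowered by 1, [01A] = [0A'], and the rule for [0A'] gives
  [0A0].\<close>

lemma NU1_step_level_1:
  assumes "is_qdv (0 # 1 # A)" "A = [] \<or> hd A \<le> 1" "last (0 # A) \<ge> -1"
  shows "NU1_step (dyck_class (0 # 1 # A)) (dyck_class (0 # A @ [0]))"
proof -
  define A' where "A' = map (\<lambda>x. x - 1) A"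
  have A: "A = word_plus A'" by (simp add: A'_def word_plus_def o_def)
  have "is_qdv (0 # A')"
    using assms(1) successively_word_plus[of "0 # A'"]
    by (simp add: A is_qdv_Cons del: successively_word_plus)
  moreover have "A' = [] \<or> hd A' \<le> 0" using assms(2) by (cases A') (auto simp: A)
  moreover have "last (0 # A') \<ge> -2"
    using assms(3) by (cases A' rule: rev_cases) (auto simp: A)
  ultimately show ?thesis
    using NU1_step_level_0[of A'] dyck_class_shift[of "0 # A'"] by (simp add: A)
qed

text \<open>Lowering once more, [012A] = [01A'] goes to [0A'0], which is [01A1] after a shift; the
  last hypothesis licenses that shift.\<close>

lemma NU1_step_level_2:
  assumes "is_qdv (0 # 1 # 2 # A)" "A = [] \<or> hd A \<le> 2" "last (0 # A) \<ge> 0" "is_qdv (0 # 1 # A @ [1])"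
  shows "NU1_step (dyck_class (0 # 1 # 2 # A)) (dyck_class (0 # 1 # A @ [1]))"
proof -
  define A' where "A' = map (\<lambda>x. x - 1) A"
  have A: "A = word_plus A'" by (simp add: A'_def word_plus_def o_def)
  have "is_qdv (0 # 1 # A')"
    using assms(1) successively_word_plus[of "0 # 1 # A'"]
    by (simp add: A is_qdv_Cons del: successively_word_plus)
  moreover have "A' = [] \<or> hd A' \<le> 1" using assms(2) by (cases A') (auto simp: A)
  moreover have "last (0 # A') \<ge> -1"
    using assms(3) by (cases A' rule: rev_cases) (auto simp: A)
  moreover have "is_qdv (0 # A' @ [0])"
    using assms(4) successively_word_plus[of "0 # A' @ [0]"]
    by (simp add: A is_qdv_Cons del: successively_word_plus)
  ultimately show ?thesis
    using NU1_step_level_1[of A'] dyck_class_shift[of "0 # 1 # A'"] dyck_class_shift[of "0 # A' @ [0]"]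
    by (simp add: A)
qed

section \<open>Orbits of a deterministic relation, cut into blocks\<close>

section \<open>Orbits listed in blocks\<close>

lemma rtranclp_hd_successively: "successively R xs \<Longrightarrow> xs \<noteq> [] \<Longrightarrow> x \<in> set xs \<Longrightarrow> R\<^sup>*\<^sup>* (hd xs) x"
proof (induction xs rule: induct_list012)
  case (3 y z xs)
  then show ?case by (auto intro: converse_rtranclp_into_rtranclp)
qed auto

lemma successively_next:
  "successively R xs \<Longrightarrow> x \<in> set xs \<Longrightarrow> x = last xs \<or> (\<exists>y \<in> set xs. R x y)"
  by (induction xs rule: induct_list012) auto

text \<open>The blocks join into one endless chain. By determinism a step from any of its elements
  stays in the chain, and every element is reached from its start.\<close>

lemma orbit_eq_blocks:
  assumes det: "\<And>x y z. R x y \<Longrightarrow> R x z \<Longrightarrow> y = z"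
    and ne: "\<And>j. L j \<noteq> []"
    and succ: "\<And>j. successively R (L j)"
    and link: "\<And>j. R (last (L j)) (hd (L (Suc j)))"
  shows "{x. R\<^sup>*\<^sup>* (hd (L 0)) x} = (\<Union>j. set (L j))"
proof (intro equalityI subsetI)
  fix x assume "x \<in> {x. R\<^sup>*\<^sup>* (hd (L 0)) x}"
  then have "R\<^sup>*\<^sup>* (hd (L 0)) x" by simp
  then show "x \<in> (\<Union>j. set (L j))"
  proof (induction rule: rtranclp_induct)
    case base
    then show ?case using ne[of 0] hd_in_set by blast
  next
    case (step y z)
    then obtain j where j: "y \<in> set (L j)" by auto
    from successively_next[OF succ j] show ?case
    proof
      assume "y = last (L j)"
      then have "z = hd (L (Suc j))" using det[OF step.hyps(2)] link by blast
      then show ?thesis using ne hd_in_set by blast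
    next
      assume "\<exists>z' \<in> set (L j). R y z'"
      then show ?thesis using det[OF step.hyps(2)] by blast
    qed
  qed
next
  fix x assume "x \<in> (\<Union>j. set (L j))"
  then obtain j where "x \<in> set (L j)" by auto
  moreover have "R\<^sup>*\<^sup>* (hd (L 0)) (hd (L j))"
  proof (induction j)
    case (Suc j)
    have "R\<^sup>*\<^sup>* (hd (L j)) (last (L j))" using rtranclp_hd_successively[OF succ ne] ne by simp
    with Suc link show ?case by (meson rtranclp.rtrancl_into_rtrancl rtranclp_trans)
  qed simp
  ultimately show "x \<in> {x. R\<^sup>*\<^sup>* (hd (L 0)) x}"
    using rtranclp_hd_successively[OF succ ne] by (auto intro: rtranclp_trans)
qed

text \<open>Reduces the theorem to exhibiting the blocks: min_Delta is \<open>m + j\<close> on block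
  \<open>j\<close>, so it singles out that block in the orbit, and each step raises dinv, which
  gives the order.\<close>

lemma plateau_lists:
  assumes TI: "TI \<mu> = hd (L 0)"
    and ne: "\<And>j. L j \<noteq> []"
    and succ: "\<And>j. successively NU1_step (L j)"
    and link: "\<And>j. NU1_step (last (L j)) (hd (L (Suc j)))"
    and delta: "\<And>j c. c \<in> set (L j) \<Longrightarrow> class_min_delta c = m + j"
  shows "lists_by_dinv (L j) (plateau \<mu> j)"
proof -
  have "TAIL \<mu> = (\<Union>j. set (L j))"
    unfolding TAIL_def TI
    by (rule orbit_eq_blocks) (use NU1_step_deterministic ne succ link in blast)+
  moreover have "class_min_delta (TI \<mu>) = m"
    using delta[of "TI \<mu>" 0] ne[of 0] TI by simp
  ultimately have "plateau \<mu> j = set (L j)"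
    using delta by (auto simp: plateau_def)
  moreover have "successively (\<lambda>c d. class_dinv c < class_dinv d) (L j)"
    using succ[of j] by (rule successively_mono) (simp add: NU1_step_class_dinv)
  then have "sorted_wrt (\<lambda>c d. class_dinv c < class_dinv d) (L j)"
    by (subst (asm) successively_conv_sorted_wrt) (auto simp: transp_def)
  ultimately show ?thesis by (simp add: lists_by_dinv_def)
qed

section \<open>Words over 0 and 1, partly raised\<close>

section \<open>Binary words\<close>

lemma successively_binary: "set W \<subseteq> {0, 1} \<Longrightarrow> successively (\<lambda>a b. b \<le> a + 1) W" for W :: "int list"
  by (induction W rule: induct_list012) auto

lemma set_replicate_subset [simp]: "x \<in> S \<Longrightarrow> set (replicate n x) \<subseteq> S"
  by auto

lemma is_qdv_binary: "set W \<subseteq> {0, 1} \<Longrightarrow> is_qdv (0 # W)"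
  using successively_binary[of "0 # W"] by (simp add: is_qdv_Cons)

lemma is_qdv_raised_binary:
  assumes "set Z \<subseteq> {0, 1}" "set V \<subseteq> {0, 1}"
  shows "is_qdv (0 # 1 # word_plus Z @ V)"
proof -
  \<comment> \<open>The letter 1 is read as a raised 0. This block then has letters at least 1, so
    its junction with the binary word \<open>V\<close> is harmless.\<close>
  have "successively (\<lambda>a b. b \<le> a + 1) (word_plus (0 # Z))"
    unfolding successively_word_plus using successively_binary[of "0 # Z"] assms(1) by simp
  moreover have "last (word_plus (0 # Z)) \<ge> 1"
    using assms(1) last_in_set[of "word_plus (0 # Z)"] by (auto simp: word_plus_def)
  moreover have "V \<noteq> [] \<Longrightarrow> hd V \<le> 1" using assms(2) by (cases V) auto
  ultimately have "successively (\<lambda>a b. b \<le> a + 1) (word_plus (0 # Z) @ V)"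
    unfolding successively_append_iff using successively_binary[OF assms(2)] by fastforce
  then show ?thesis by (simp add: is_qdv_Cons)
qed

lemma last_Cons_0_nonneg: "\<forall>x \<in> set A. x \<ge> 0 \<Longrightarrow> last (0 # A) \<ge> (0::int)"
  using last_in_set[of "0 # A"] by auto

text \<open>For z = 0 the word starts 011 and the level 1 rule appends 0; for z = 1 it starts 012
  and the level 2 rule appends 1. In both cases z itself is moved to the end.\<close>

lemma NU1_step_move:
  assumes "set (z # Z) \<subseteq> {0, 1}" "set V \<subseteq> {0, 1}"
  shows "NU1_step (dyck_class (0 # 1 # word_plus (z # Z) @ V))
                  (dyck_class (0 # 1 # word_plus Z @ V @ [z]))"
proof -
  define A where "A = word_plus Z @ V"
  have A: "set A \<subseteq> {0, 1, 2}" using assms by (auto simp: A_def word_plus_def)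
  then have "\<forall>x \<in> set A. x \<ge> 0" by auto
  then have "last (0 # A) \<ge> 0" "last (0 # 1 # A) \<ge> 0"
    using last_Cons_0_nonneg[of A] last_Cons_0_nonneg[of "1 # A"] by simp_all
  moreover have "A = [] \<or> hd A \<le> 2" using A by (cases A) auto
  moreover have "is_qdv (0 # 1 # (z + 1) # A)"
    using is_qdv_raised_binary[OF assms] by (simp add: A_def)
  moreover have "is_qdv (0 # 1 # A @ [z])"
    using is_qdv_raised_binary[of Z "V @ [z]"] assms by (simp add: A_def)
  ultimately show ?thesis
    using assms(1) NU1_step_level_1[of "1 # A"] NU1_step_level_2[of A] by (auto simp: A_def)
qed

lemma NU1_step_binary_level_1:
  assumes "set A \<subseteq> {0, 1}"
  shows "NU1_step (dyck_class (0 # 1 # A)) (dyck_class (0 # A @ [0]))"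
proof (rule NU1_step_level_1)
  show "is_qdv (0 # 1 # A)" using is_qdv_binary[of "1 # A"] assms by simp
  show "A = [] \<or> hd A \<le> 1" using assms by (cases A) auto
  have "last (0 # A) \<ge> 0" using assms by (intro last_Cons_0_nonneg) auto
  then show "last (0 # A) \<ge> -1" by linarith
qed

lemma NU1_step_binary_level_0:
  assumes "set A \<subseteq> {0, 1}" "A = [] \<or> hd A = 0"
  shows "NU1_step (dyck_class (0 # A)) (dyck_class (0 # word_plus A @ [0]))"
proof (rule NU1_step_level_0)
  show "is_qdv (0 # A)" using is_qdv_binary assms by simp
  show "A = [] \<or> hd A \<le> 0" using assms(2) by auto
  have "last (0 # A) \<ge> 0" using assms by (intro last_Cons_0_nonneg) auto
  then show "last (0 # A) \<ge> -2" by linarith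
qed

lemma class_min_delta_binary:
  "set W \<subseteq> {0, 1} \<Longrightarrow> W = [] \<or> 0 \<in> set W \<Longrightarrow> class_min_delta (dyck_class (0 # W)) = Suc (length W)"
  by (subst class_min_delta_dyck) (auto intro: is_qdv_binary)

lemma class_min_delta_raised_binary:
  assumes "set Z \<subseteq> {0, 1}" "set V \<subseteq> {0, 1}" "0 \<in> set V"
  shows "class_min_delta (dyck_class (0 # 1 # word_plus Z @ V)) = 2 + length Z + length V"
  using assms is_qdv_raised_binary[OF assms(1,2)]
  by (subst class_min_delta_dyck) (auto simp: word_plus_def)

lemma successively_map_upt:
  "(\<And>i. a \<le> i \<Longrightarrow> Suc i < b \<Longrightarrow> R (f i) (f (Suc i))) \<Longrightarrow> successively R (map f [a..<b])"
  by (auto simp: successively_conv_nth)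

lemma B_word_Nil [simp]: "B_word [] = []"
  by (simp add: B_word_def part_def)

lemma set_B_word: "set (B_word m) \<subseteq> {0, 1}"
  by (auto simp: B_word_def)

text \<open>The block of 1 supplies the leading 0; the block of the largest part has a 1 because
  that part occurs. Length at least 2 ensures that a splitting into nonempty Y and Z exists.\<close>

lemma B_word_nonzero:
  assumes "int_partition m" "m \<noteq> []"
  obtains C where "B_word m = 0 # C" "C \<noteq> []"
proof -
  define r where "r = part m 1"
  define f where "f = (\<lambda>i. (0::int) # replicate (count_list m i) 1)"
  have r: "r \<in> set m" "r > 0"
    using assms by (cases m; simp add: r_def part_def int_partition_def)+
  have "B_word m = concat (map f [1..<r]) @ f r"
    using r(2) unfolding B_word_def r_def[symmetric] f_def by simp
  moreover have "length (f r) \<ge> 2" using r(1) count_list_0_iff[of m r] by (auto simp: f_def Suc_le_eq)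
  ultimately have "length (B_word m) \<ge> 2" by simp
  moreover have "[1..<Suc r] = 1 # [2..<Suc r]" using r(2) by (simp add: upt_conv_Cons numeral_2_eq_2 del: upt_Suc)
  then have "B_word m = f 1 @ concat (map f [2..<Suc r])"
    unfolding B_word_def r_def[symmetric] f_def by (simp del: upt_Suc)
  then have "hd (B_word m) = 0" by (simp add: f_def)
  ultimately show ?thesis by (cases "B_word m"; cases "tl (B_word m)") (auto intro: that)
qed

section \<open>The plateaus as explicit blocks of the orbit\<close>

section \<open>The plateaus\<close>

lemma plateau_nonzero:
  assumes "int_partition \<mu>" "\<mu> \<noteq> []" "j > 0"
  shows "lists_by_dinv
     (map (\<lambda>k. dyck_class ([0, 1] @ word_plus (drop k (B_word \<mu>)) @ replicate (j - 1) 1 @ take k (B_word \<mu>)))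
        [1..<length (B_word \<mu>)]
      @ map (\<lambda>b. dyck_class ([0] @ replicate (j - b) 1 @ B_word \<mu> @ replicate b 0)) [0..<Suc j])
     (plateau \<mu> j)"
proof -
  define B where "B = B_word \<mu>"
  obtain C where C: "B = 0 # C" "C \<noteq> []"
    using B_word_nonzero[OF assms(1,2)] unfolding B_def .
  have bin: "set B \<subseteq> {0, 1}" unfolding B_def by (rule set_B_word)
  have sub: "set (drop k B) \<subseteq> {0, 1}" "set (take k B) \<subseteq> {0, 1}" for k
    using bin set_drop_subset[of k B] set_take_subset[of k B] by blast+
  have len: "1 < length B" using C by (cases C) auto
  define a where
    "a j k = dyck_class (0 # 1 # word_plus (drop k B) @ replicate (j - 1) 1 @ take k B)" for j k
  define b where
    "b j i = dyck_class (0 # replicate (j - i) 1 @ B @ replicate i 0)" for j i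
  \<comment> \<open>Block 0 is the single class [0B], the starting point of the tail.\<close>
  define L where "L j = (if j = 0 then [] else map (a j) [1..<length B]) @ map (b j) [0..<Suc j]" for j
  have step_a: "NU1_step (a j k) (a j (Suc k))" if "k < length B" for j k
  proof -
    have "drop k B = B ! k # drop (Suc k) B" using that by (simp add: Cons_nth_drop_Suc)
    then show ?thesis
      using NU1_step_move[of "B ! k" "drop (Suc k) B" "replicate (j - 1) 1 @ take k B"] sub(1)[of k] sub(2)[of k]
      by (auto simp: a_def take_Suc_conv_app_nth[OF that])
  qed
  \<comment> \<open>With Z used up, [01 1^(j-1) B] is already the word with b = 0.\<close>
  have a_b: "a j (length B) = b j 0" if "j > 0" for j
    using that by (cases j) (auto simp: a_def b_def)
  have step_b: "NU1_step (b j i) (b j (Suc i))" if "i < j" for j i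
  proof -
    have "j - i = Suc (j - Suc i)" using that by simp
    then show ?thesis
      using NU1_step_binary_level_1[of "replicate (j - Suc i) 1 @ B @ replicate i 0"] bin
      by (auto simp: b_def replicate_append_same)
  qed
  \<comment> \<open>Writing B = 0C, the word 0B0^j becomes 01C^+1^j0, which is the splitting Y = 0,
    Z = C one plateau higher.\<close>
  have step_b_a: "NU1_step (b j j) (a (Suc j) 1)" for j
    using NU1_step_binary_level_0[of "B @ replicate j 0"] bin by (auto simp: a_def b_def C)
  have "lists_by_dinv (L j) (plateau \<mu> j)"
  proof (rule plateau_lists)
    show "TI \<mu> = hd (L 0)" by (simp add: TI_def L_def b_def B_def)
    show "L j \<noteq> []" for j by (simp add: L_def)
    show "NU1_step (last (L j)) (hd (L (Suc j)))" for j
      using step_b_a[of j] len by (auto simp add: L_def hd_append hd_map)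
    show "successively NU1_step (L j)" for j
    proof -
      have "successively NU1_step (map (a j) [1..<length B])"
        by (rule successively_map_upt) (simp add: step_a)
      moreover have "successively NU1_step (map (b j) [0..<Suc j])"
        by (rule successively_map_upt) (simp add: step_b)
      moreover have "NU1_step (last (map (a j) [1..<length B])) (hd (map (b j) [0..<Suc j]))" if "j > 0"
      proof -
        \<comment> \<open>The last splitting leaves one letter in Z; moving it gives
          \<open>a j (length B)\<close>, which is \<open>b j 0\<close>.\<close>
        have "last (map (a j) [1..<length B]) = a j (length B - 1)"
          using len by (subst last_map) auto
        then show ?thesis
          using step_a[of "length B - 1" j] a_b[OF that] len
          by (cases "length B") (simp_all add: hd_map del: upt_Suc)
      qed
      ultimately show ?thesis by (simp add: L_def successively_append_iff del: upt_Suc)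
    qed
    fix j c assume "c \<in> set (L j)"
    then consider k where "j > 0" "1 \<le> k" "k < length B" "c = a j k" | i where "i \<le> j" "c = b j i"
      by (auto simp: L_def image_iff less_Suc_eq_le simp del: upt_Suc split: if_splits)
    then show "class_min_delta c = Suc (length B) + j"
    proof cases
      case 1
      \<comment> \<open>Y is nonempty and B starts with 0, so Y supplies the noninitial 0. The
        length is 2 + |Z| + (j - 1) + |Y| = |B| + 1 + j.\<close>
      then have "0 \<in> set (take k B)" by (simp add: C take_Cons')
      then show ?thesis
        using class_min_delta_raised_binary[of "drop k B" "replicate (j - 1) 1 @ take k B"] sub 1
        by (auto simp: a_def)
    next
      case 2
      then show ?thesis
        using class_min_delta_binary[of "replicate (j - i) 1 @ B @ replicate i 0"] bin
        by (auto simp: b_def C)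
    qed
  qed
  then show ?thesis
    using assms(3) unfolding L_def a_def b_def B_def by simp
qed

lemma plateau_zero:
  assumes "j > 0"
  shows "lists_by_dinv
     (map (\<lambda>b. dyck_class ([0] @ replicate (j - b) 1 @ replicate b 0)) [1..<Suc j]) (plateau [] j)"
proof -
  define b where "b j i = dyck_class (0 # replicate (j - i) 1 @ replicate i 0)" for j i
  \<comment> \<open>The value b = 0 is left out for j > 0 because [01^j] = [0^j] ends the previous
    block. At j = 0 the range would be empty, so [0] is listed by hand.\<close>
  define L where "L j = (if j = 0 then [b 0 0] else map (b j) [1..<Suc j])" for j
  have step_b: "NU1_step (b j i) (b j (Suc i))" if "i < j" for j i
  proof -
    have "j - i = Suc (j - Suc i)" using that by simp
    then show ?thesis
      using NU1_step_binary_level_1[of "replicate (j - Suc i) 1 @ replicate i 0"]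
      by (auto simp: b_def replicate_append_same)
  qed
  \<comment> \<open>The word 00^j becomes 01^j0, the case b = 1 of the next block.\<close>
  have link: "NU1_step (b j j) (b (Suc j) 1)" for j
    using NU1_step_binary_level_0[of "replicate j 0"] by (cases j) (simp_all add: b_def)
  have "lists_by_dinv (L j) (plateau [] j)"
  proof (rule plateau_lists)
    show "TI [] = hd (L 0)" by (simp add: TI_def L_def b_def)
    show "L j \<noteq> []" for j by (simp add: L_def)
    show "NU1_step (last (L j)) (hd (L (Suc j)))" for j
      using link[of j] by (auto simp: L_def hd_map last_map simp del: upt_Suc)
    show "successively NU1_step (L j)" for j
      unfolding L_def using successively_map_upt[of 1 "Suc j" NU1_step "b j"] step_b
      by (simp del: upt_Suc)
    fix j c assume "c \<in> set (L j)"
    then obtain i where "i \<le> j" "i = 0 \<longrightarrow> j = 0" "c = b j i"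
      by (auto simp: L_def image_iff Suc_le_eq less_Suc_eq_le simp del: upt_Suc split: if_splits)
    then show "class_min_delta c = 1 + j"
      using class_min_delta_binary[of "replicate (j - i) 1 @ replicate i 0"] by (auto simp: b_def)
  qed
  then show ?thesis
    using assms unfolding L_def b_def by simp
qed

theorem theorem2p17:
  fixes \<mu> :: "nat list" and j :: nat
  assumes "int_partition \<mu>" and "j > 0"
  shows "(\<mu> \<noteq> [] \<longrightarrow>
           lists_by_dinv
             (map (\<lambda>k. let Y = take k (B_word \<mu>); Z = drop k (B_word \<mu>)
                       in dyck_class ([0, 1] @ word_plus Z @ replicate (j - 1) 1 @ Y))
                  [1..<length (B_word \<mu>)]
              @ map (\<lambda>b. dyck_class ([0] @ replicate (j - b) 1 @ B_word \<mu> @ replicate b 0))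
                  [0..<Suc j])
             (plateau \<mu> j))
       \<and> (\<mu> = [] \<longrightarrow>
           lists_by_dinv
             (map (\<lambda>b. dyck_class ([0] @ replicate (j - b) 1 @ replicate b 0)) [1..<Suc j])
             (plateau \<mu> j))"
  unfolding Let_def using plateau_nonzero[OF assms(1) _ assms(2)] plateau_zero[OF assms(2)] by blast

end
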